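(* For every integer $n\ge 1$, the convex geometric Ramsey number of the ladder graph satisfies $R_c(L_{2n})\le 32n^3$.
   Context: A finite point set $P\subset\mathbb{R}^2$ is in general position if no three points are collinear, and in convex position if it is the vertex set of a convex polygon. $K_P$ denotes the complete geometric graph on $P$: the complete graph on $P$ with edges drawn as straight-line segments. Given a $2$-colouring (red/blue) of the edges of $K_P$ and a graph $G$, a monochromatic non-crossing copy of $G$ is an injective map $\phi:V(G)\to P$ such that all segments $\phi(x)\phi(y)$, $xy\in E(G)$, have the same colour and no two of these segments cross (i.e. share a point other than a common endpoint). The convex geometric Ramsey number $R_c(G)$ is the smallest $N$ such that for every set $P$ of $N$ points in convex position, every $2$-colouring of the edges of $K_P$ contains a monochromatic non-crossing copy of $G$. The ladder graph $L_{2n}$ consists of two paths $u_1u_2\cdots u_n$ and $v_1v_2\cdots v_n$ together with the edges $u_iv_i$ for $i\in[n]$. *)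

theory Defs
  imports "HOL-Analysis.Analysis"
begin

type_synonym point = "real \<times> real"

text \<open>Convex position: finite and no point lies in the convex hull of the others
  (vertex set of a convex polygon; this also implies general position).\<close>
definition convex_pos :: "point set \<Rightarrow> bool" where
  "convex_pos P \<longleftrightarrow> finite P \<and> (\<forall>p\<in>P. p \<notin> convex hull (P - {p}))"

text \<open>A graph is given by a vertex set V and a set E of edges, each edge an ordered
  pair (x,y) standing for the unordered edge xy. A 2-colouring of K_P is a function
  c on the 2-element subsets of P (values on other sets are irrelevant).\<close>
definition mono_noncrossing_copy ::
  "'v set \<Rightarrow> ('v \<times> 'v) set \<Rightarrow> point set \<Rightarrow> (point set \<Rightarrow> bool) \<Rightarrow> ('v \<Rightarrow> point) \<Rightarrow> bool" where
  "mono_noncrossing_copy V E P c \<phi> \<longleftrightarrow>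
     inj_on \<phi> V \<and> \<phi> ` V \<subseteq> P \<and>
     (\<exists>col. \<forall>(x,y)\<in>E. c {\<phi> x, \<phi> y} = col) \<and>
     (\<forall>(x,y)\<in>E. \<forall>(u,w)\<in>E.
        closed_segment (\<phi> x) (\<phi> y) \<inter> closed_segment (\<phi> u) (\<phi> w)
          \<subseteq> {\<phi> x, \<phi> y} \<inter> {\<phi> u, \<phi> w}
        \<or> {\<phi> x, \<phi> y} = {\<phi> u, \<phi> w})"

definition rc_holds :: "'v set \<Rightarrow> ('v \<times> 'v) set \<Rightarrow> nat \<Rightarrow> bool" where
  "rc_holds V E N \<longleftrightarrow>
     (\<forall>P :: point set. convex_pos P \<and> card P = N \<longrightarrow>
        (\<forall>c :: point set \<Rightarrow> bool. \<exists>\<phi>. mono_noncrossing_copy V E P c \<phi>))"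

definition Rc :: "'v set \<Rightarrow> ('v \<times> 'v) set \<Rightarrow> nat" where
  "Rc V E = (LEAST N. rc_holds V E N)"

text \<open>Ladder L_{2n}: vertices u_i = (False,i), v_i = (True,i), i in 1..n.\<close>
definition ladder_V :: "nat \<Rightarrow> (bool \<times> nat) set" where
  "ladder_V n = UNIV \<times> {1..n}"

definition ladder_E :: "nat \<Rightarrow> ((bool \<times> nat) \<times> (bool \<times> nat)) set" where
  "ladder_E n = {((b,i),(b,i+1)) | b i. 1 \<le> i \<and> i < n}
              \<union> {((False,i),(True,i)) | i. 1 \<le> i \<and> i \<le> n}"

end

theory Submission
  imports Defs
begin

text \<open>Number the points in convex position cyclically and let \<open>A\<close>, \<open>B\<close> be the two halves, each of
  size \<open>M = 16 n\<^sup>3\<close>; say that red is the majority colour between \<open>A\<close> and \<open>B\<close>. If there is no red ladder with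
  rungs from \<open>A\<close> to \<open>B\<close>, classifying the red rungs by the longest red ladder ending in them gives a
  set \<open>H\<close> of at least \<open>8 n\<^sup>2 M\<close> rungs, no two of which extend each other. By averaging, some cut of \<open>B\<close>
  leaves at least \<open>2 n\<^sup>2\<close> \<open>H\<close>-neighbours on both sides for \<open>2 n\<close> vertices of \<open>A\<close>. If these vertices
  form a blue clique, it contains a blue ladder. Otherwise two of them are joined by a red edge, which
  forces all edges between the upper neighbours of one and the lower neighbours of the other to
  be blue. Within each of these two sets there is either a red clique of size \<open>2 n\<close> or a blue
  monotone path of \<open>n\<close> vertices, and two such paths form a blue ladder.\<close>

section \<open>Long chains or large independent classes\<close>

text \<open>Class each element by the largest number of members in a chain ending there. Two related
  elements of one class would lengthen such a chain. If no chain has \<open>n\<close> members, only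
  the \<open>n\<close> lengths below \<open>n\<close> occur, and pigeonhole yields
  \<open>Y\<close>.\<close>

lemma chain_or_independent:
  fixes r :: "'a \<Rightarrow> 'a \<Rightarrow> bool"
  assumes "finite X"
  obtains (chain) f where "\<And>i. i \<in> {1..n} \<Longrightarrow> f i \<in> X" "\<And>i. i \<in> {1..<n} \<Longrightarrow> r (f i) (f (Suc i))"
  | (indep) Y where "Y \<subseteq> X" "card X \<le> n * card Y" "\<And>x y. x \<in> Y \<Longrightarrow> y \<in> Y \<Longrightarrow> \<not> r x y"
proof -
  \<comment> \<open>\<open>m\<close> counts members. For \<open>m = 0\<close> the only demand is
    \<open>f 0 = x\<close>, so \<open>ends 0 x\<close> always holds and the least failing length in
    \<open>cover\<close> is a successor.\<close>
  define ends where "ends m x \<longleftrightarrow> (\<exists>f. f m = x \<and> (\<forall>i\<in>{1..m}. f i \<in> X) \<and> (\<forall>i\<in>{1..<m}. r (f i) (f (Suc i))))"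
    for m x
  define L where "L m = {x\<in>X. ends m x \<and> \<not> ends (Suc m) x}" for m
  show thesis
  proof (cases "\<exists>x. ends n x")
    case True
    then show thesis using chain unfolding ends_def by blast
  next
    case False
    have step: "ends (Suc m) y" if ends: "ends m x" and "r x y" "y \<in> X" for m x y
    proof -
      obtain f where f: "f m = x" "\<forall>i\<in>{1..m}. f i \<in> X" "\<forall>i\<in>{1..<m}. r (f i) (f (Suc i))"
        using ends unfolding ends_def by blast
      have "r (if i = Suc m then y else f i) (if Suc i = Suc m then y else f (Suc i))" if "i \<in> {1..<Suc m}" for i
        using f that \<open>r x y\<close> by (cases "i = m") auto
      then show ?thesis
        unfolding ends_def using f \<open>y \<in> X\<close> by (intro exI[of _ "f(Suc m := y)"]) auto
    qed
    have cover: "X \<subseteq> (\<Union>m\<in>{..<n}. L m)"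
    proof
      fix x assume x: "x \<in> X"
      have zero: "ends 0 x" unfolding ends_def by (intro exI[of _ "\<lambda>_. x"]) auto
      define k where "k = (LEAST k. \<not> ends k x)"
      have "\<not> ends n x" using False by blast
      then have k: "\<not> ends k x" "k \<le> n" unfolding k_def by (rule LeastI, rule Least_le)
      with zero obtain m where m: "k = Suc m" by (cases k) auto
      have "ends m x" using not_less_Least[of m "\<lambda>k. \<not> ends k x"] m k_def by auto
      with k m x show "x \<in> (\<Union>m\<in>{..<n}. L m)" unfolding L_def by auto
    qed
    have fin: "finite (L m)" for m using assms unfolding L_def by auto
    have "\<exists>m. card X \<le> n * card (L m)"
    proof (rule ccontr)
      assume "\<not> ?thesis"
      then have small: "n * card (L m) < card X" for m by (auto simp: not_le)
      have "card X \<le> card (\<Union>m\<in>{..<n}. L m)" using cover fin by (intro card_mono) auto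
      also have "\<dots> \<le> (\<Sum>m<n. card (L m))" by (rule card_UN_le) auto
      finally have *: "card X \<le> (\<Sum>m<n. card (L m))" .
      have "n > 0" using * small[of 0] by (cases n) auto
      have "n * card X \<le> (\<Sum>m<n. n * card (L m))" using * by (simp flip: sum_distrib_left)
      also have "\<dots> < (\<Sum>m<n. card X)" using \<open>n > 0\<close> small by (intro sum_strict_mono) auto
      finally show False by simp
    qed
    then obtain m where "card X \<le> n * card (L m)" by blast
    then show thesis
      by (rule indep[rotated]) (use step in \<open>auto simp: L_def\<close>)
  qed
qed

section \<open>Ladders on linearly ordered indices\<close>

text \<open>A ladder whose vertices appear in the order \<open>u 1 < \<dots> < u n < v n < \<dots> < v 1\<close>.
  \<open>K\<close> is only consulted with its smaller argument first.\<close>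

definition index_ladder :: "(nat \<Rightarrow> nat \<Rightarrow> bool) \<Rightarrow> nat set \<Rightarrow> nat \<Rightarrow> (nat \<Rightarrow> nat) \<Rightarrow> (nat \<Rightarrow> nat) \<Rightarrow> bool" where
  "index_ladder K S n u v \<longleftrightarrow>
     (\<forall>i\<in>{1..n}. u i \<in> S \<and> v i \<in> S \<and> u i < v i \<and> K (u i) (v i)) \<and>
     (\<forall>i\<in>{1..<n}. u i < u (Suc i) \<and> v (Suc i) < v i \<and> K (u i) (u (Suc i)) \<and> K (v (Suc i)) (v i))"

lemma index_ladder_mono: "index_ladder K S n u v \<Longrightarrow> S \<subseteq> T \<Longrightarrow> index_ladder K T n u v"
  unfolding index_ladder_def by blast

lemma index_ladder_of_clique:
  assumes "finite S" "2 * n \<le> card S" and K: "\<And>x y. x \<in> S \<Longrightarrow> y \<in> S \<Longrightarrow> x < y \<Longrightarrow> K x y"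
  shows "\<exists>u v. index_ladder K S n u v"
proof -
  define l where "l = sorted_list_of_set S"
  have l: "length l = card S" "set l = S" "sorted_wrt (<) l"
    using assms(1) by (auto simp: l_def)
  have mem: "l ! i \<in> S" if "i < 2 * n" for i
    using l assms(2) that by (metis nth_mem order_less_le_trans)
  have less: "l ! i < l ! j" if "i < j" "j < 2 * n" for i j
    using l assms(2) that by (auto intro: sorted_wrt_nth_less)
  show ?thesis
    unfolding index_ladder_def
    \<comment> \<open>Positions \<open>0\<close> to \<open>n - 1\<close> ascend along
      \<open>u\<close>; positions \<open>2 * n - 1\<close> down to \<open>n\<close> descend along
      \<open>v\<close>.\<close>
    by (intro exI[of _ "\<lambda>i. l ! (i - 1)"] exI[of _ "\<lambda>i. l ! (2 * n - i)"])
       (auto intro!: K mem less)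
qed

text \<open>The complete bipartite pattern supplies every rung, so only the two sides must be found.
  In each of \<open>Y\<close> and \<open>X\<close> there is either an increasing
  \<open>K\<close>-path on \<open>n\<close> vertices or a set of \<open>2 * n\<close> vertices
  without \<open>K\<close>-edges, which already carries a ladder of the other colour.\<close>

lemma index_ladder_of_blown_up_edge:
  assumes fin: "finite Y" "finite X" and card: "2 * n * n \<le> card Y" "2 * n * n \<le> card X"
    and K: "\<And>y x. y \<in> Y \<Longrightarrow> x \<in> X \<Longrightarrow> y < x \<and> K y x"
  shows "\<exists>col u v. index_ladder (\<lambda>i j. K i j = col) (Y \<union> X) n u v"
proof (rule ccontr)
  assume no: "\<not> ?thesis"
  have path: "\<exists>f. (\<forall>i\<in>{1..n}. f i \<in> Z) \<and> (\<forall>i\<in>{1..<n}. f i < f (Suc i) \<and> K (f i) (f (Suc i)))"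
    if Z: "Z \<subseteq> Y \<union> X" "2 * n * n \<le> card Z" for Z
  proof -
    have fZ: "finite Z" using Z fin finite_subset by blast
    show ?thesis
    proof (rule chain_or_independent[OF fZ, where n = n and r = "\<lambda>x y. x < y \<and> K x y"])
      fix W assume W: "W \<subseteq> Z" "card Z \<le> n * card W" "\<And>x y. x \<in> W \<Longrightarrow> y \<in> W \<Longrightarrow> \<not> (x < y \<and> K x y)"
      have "n * (2 * n) \<le> card Z" using Z(2) by (simp add: ac_simps)
      also note W(2)
      finally have "2 * n \<le> card W" by (cases "n = 0") simp_all
      then have "\<exists>u v. index_ladder (\<lambda>i j. K i j = False) W n u v"
        using W fZ finite_subset by (intro index_ladder_of_clique) auto
      then obtain u v where "index_ladder (\<lambda>i j. K i j = False) W n u v" by blast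
      then have "index_ladder (\<lambda>i j. K i j = False) (Y \<union> X) n u v"
        using W(1) Z(1) by (rule index_ladder_mono[OF _ order_trans])
      then show ?thesis using no by blast
    qed blast
  qed
  obtain f where f: "\<forall>i\<in>{1..n}. f i \<in> Y" "\<forall>i\<in>{1..<n}. f i < f (Suc i) \<and> K (f i) (f (Suc i))"
    using path[of Y] card by auto
  obtain g where g: "\<forall>i\<in>{1..n}. g i \<in> X" "\<forall>i\<in>{1..<n}. g i < g (Suc i) \<and> K (g i) (g (Suc i))"
    using path[of X] card by auto
  \<comment> \<open>The path in \<open>X\<close> is traversed backwards, so that rungs are nested:
    step \<open>i\<close> of the \<open>v\<close> side is step \<open>n - i\<close> of
    \<open>g\<close>.\<close>
  have rev: "g (n - i) < g (Suc n - i) \<and> K (g (n - i)) (g (Suc n - i))" if "i \<in> {1..<n}" for i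
    using g(2)[rule_format, of "n - i"] that by (auto simp: Suc_diff_le)
  have mem: "f i \<in> Y" "g (Suc n - i) \<in> X" if "i \<in> {1..n}" for i
  proof -
    have "Suc n - i \<in> {1..n}" using that by (simp add: Suc_le_eq; arith)
    then show "f i \<in> Y" "g (Suc n - i) \<in> X" using f(1) g(1) that by blast+
  qed
  have "index_ladder (\<lambda>i j. K i j = True) (Y \<union> X) n f (\<lambda>i. g (Suc n - i))"
    unfolding index_ladder_def using f(2) mem rev K[OF mem] by auto
  with no show False by blast
qed

section \<open>Cuts and averaging\<close>

text \<open>All these elements lie below their maximum, which itself has fewer than \<open>k\<close>
  elements of \<open>X\<close> up to it.\<close>

lemma card_low_elements:
  fixes X :: "nat set"
  assumes "finite X"
  shows "card {c\<in>X. card {x\<in>X. x \<le> c} < k} \<le> k"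
proof (cases "{c\<in>X. card {x\<in>X. x \<le> c} < k} = {}")
  case False
  let ?D = "{c\<in>X. card {x\<in>X. x \<le> c} < k}"
  have fin: "finite ?D" using assms by auto
  have "Max ?D \<in> ?D" using False fin Max_in by blast
  moreover have "card ?D \<le> card {x\<in>X. x \<le> Max ?D}"
    using assms fin by (intro card_mono) auto
  ultimately show ?thesis by auto
qed (metis card.empty le0)

text \<open>Mirror image, using the minimum. The count above it is strict, so the minimum itself
  contributes one more.\<close>

lemma card_high_elements:
  fixes X :: "nat set"
  assumes "finite X"
  shows "card {c\<in>X. card {x\<in>X. c < x} < k} \<le> k"
proof (cases "{c\<in>X. card {x\<in>X. c < x} < k} = {}")
  case False
  let ?D = "{c\<in>X. card {x\<in>X. c < x} < k}"
  have fin: "finite ?D" using assms by auto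
  have m: "Min ?D \<in> ?D" using False fin Min_in by blast
  have "card ?D \<le> card (insert (Min ?D) {x\<in>X. Min ?D < x})"
    using assms fin Min_le[OF fin] by (intro card_mono) (auto simp: le_less simp del: Min_le_iff Min_less_iff)
  also have "\<dots> \<le> Suc (card {x\<in>X. Min ?D < x})" by (rule card_insert_le_m1) auto
  finally show ?thesis using m by auto
qed (metis card.empty le0)

text \<open>The elements counted on the right serve as cuts of \<open>X\<close> leaving at least
  \<open>k\<close> elements on both sides; a cut point belongs to its lower side.\<close>

lemma card_middle_elements:
  fixes X :: "nat set"
  assumes "finite X"
  shows "card X \<le> card {c\<in>X. k \<le> card {x\<in>X. x \<le> c} \<and> k \<le> card {x\<in>X. c < x}} + 2 * k"
    (is "_ \<le> card ?M + _")
proof -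
  let ?L = "{c\<in>X. card {x\<in>X. x \<le> c} < k}" and ?H = "{c\<in>X. card {x\<in>X. c < x} < k}"
  have "card X \<le> card (?M \<union> (?L \<union> ?H))" using assms by (intro card_mono) auto
  also have "\<dots> \<le> card ?M + (card ?L + card ?H)"
    by (meson card_Un_le nat_add_left_cancel_le order_trans)
  finally show ?thesis
    using card_low_elements[OF assms, of k] card_high_elements[OF assms, of k] by linarith
qed

text \<open>Double counting of the pairs \<open>(a, c)\<close> with \<open>c \<in> G a\<close>: the
  average over \<open>c \<in> B\<close> is at least \<open>d\<close>.\<close>

lemma popular_element:
  assumes "finite A" "finite B" "B \<noteq> {}" "\<And>a. a \<in> A \<Longrightarrow> G a \<subseteq> B" "d * card B \<le> (\<Sum>a\<in>A. card (G a))"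
  obtains c where "c \<in> B" "d \<le> card {a\<in>A. c \<in> G a}"
proof -
  have "(\<Sum>a\<in>A. card (G a)) = (\<Sum>a\<in>A. \<Sum>c\<in>B. if c \<in> G a then 1 else 0)"
  proof (rule sum.cong)
    fix a assume "a \<in> A"
    then have "{c\<in>B. c \<in> G a} = G a" using assms(4) by blast
    then show "card (G a) = (\<Sum>c\<in>B. if c \<in> G a then 1 else 0)"
      using assms(2) by (simp flip: sum.inter_filter)
  qed simp
  also have "\<dots> = (\<Sum>c\<in>B. card {a\<in>A. c \<in> G a})"
    using assms(1) by (subst sum.swap) (simp flip: sum.inter_filter)
  finally have eq: "(\<Sum>a\<in>A. card (G a)) = (\<Sum>c\<in>B. card {a\<in>A. c \<in> G a})" .
  have "\<exists>c\<in>B. d \<le> card {a\<in>A. c \<in> G a}"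
  proof (rule ccontr)
    assume "\<not> ?thesis"
    then have "(\<Sum>c\<in>B. card {a\<in>A. c \<in> G a}) < (\<Sum>c\<in>B. d)"
      using assms by (intro sum_strict_mono) auto
    then show False using assms(5) eq by (simp add: mult.commute)
  qed
  then show thesis using that by blast
qed

section \<open>A monochromatic index ladder in every colouring\<close>

lemma index_ladder_of_dense:
  assumes n: "n \<ge> 1" and M: "M = 16 * n ^ 3"
    and dense: "M * M \<le> 2 * card {(a, b). a < M \<and> M \<le> b \<and> b < 2 * M \<and> K a b}"
  shows "\<exists>col u v. index_ladder (\<lambda>i j. K i j = col) {..<2 * M} n u v"
proof -
  define E where "E = {(a, b). a < M \<and> M \<le> b \<and> b < 2 * M \<and> K a b}"
  \<comment> \<open>The second rung lies strictly inside the first and both connecting side edges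
    have colour \<open>K\<close>, so a chain of \<open>n\<close> rungs is a ladder.\<close>
  define r where "r = (\<lambda>(a, b) (a', b'). a < a' \<and> b' < b \<and> K a a' \<and> K b' b)"
  have finE: "finite E"
    by (rule finite_subset[of _ "{..<M} \<times> {..<2 * M}"]) (auto simp: E_def)
  show ?thesis
  proof (rule chain_or_independent[OF finE, where n = n and r = r])
    fix f assume f: "\<And>i. i \<in> {1..n} \<Longrightarrow> f i \<in> E" "\<And>i. i \<in> {1..<n} \<Longrightarrow> r (f i) (f (Suc i))"
    have "index_ladder (\<lambda>i j. K i j = True) {..<2 * M} n (\<lambda>i. fst (f i)) (\<lambda>i. snd (f i))"
      unfolding index_ladder_def using f by (fastforce simp: E_def r_def case_prod_beta)
    then show ?thesis by blast
  next
    fix H assume H: "H \<subseteq> E" "card E \<le> n * card H" and indep: "\<And>x y. x \<in> H \<Longrightarrow> y \<in> H \<Longrightarrow> \<not> r x y"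
    define \<Gamma> where "\<Gamma> a = {b. (a, b) \<in> H}" for a
    \<comment> \<open>The cuts usable for \<open>a\<close>: either side keeps
      \<open>2 * n * n\<close> neighbours, the size that
      \<open>index_ladder_of_blown_up_edge\<close> requires.\<close>
    define G where "G a = {c \<in> \<Gamma> a. 2 * n * n \<le> card {x\<in>\<Gamma> a. x \<le> c} \<and> 2 * n * n \<le> card {x\<in>\<Gamma> a. c < x}}" for a
    have \<Gamma>_sub: "\<Gamma> a \<subseteq> {M..<2 * M}" for a using H by (auto simp: \<Gamma>_def E_def)
    then have fin\<Gamma>: "finite (\<Gamma> a)" for a using finite_subset by blast
    \<comment> \<open>The class \<open>H\<close> has at least \<open>M * M / (2 * n)\<close> rungs;
      the constant 16 in \<open>M\<close> turns this into \<open>8 * n ^ 2 * M\<close>.\<close>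
    have "(2 * n) * (8 * n ^ 2 * M) = M * M" by (simp add: M power2_eq_square power3_eq_cube)
    also have "\<dots> \<le> (2 * n) * card H" using dense H unfolding E_def by simp
    finally have "8 * n ^ 2 * M \<le> card H \<or> 2 * n = 0" unfolding mult_le_cancel1 by blast
    then have cardH: "8 * n ^ 2 * M \<le> card H" using n by auto
    have "H = Sigma {..<M} \<Gamma>" using H by (auto simp: \<Gamma>_def E_def)
    then have "card H = (\<Sum>a<M. card (\<Gamma> a))" using fin\<Gamma> by simp
    \<comment> \<open>Each \<open>a\<close> loses at most \<open>4 * n ^ 2\<close> neighbours as
      cuts, in total at most half of the bound on \<open>H\<close>. The other half, averaged over
      \<open>M\<close> cut positions, gives the common cut \<open>c\<close>.\<close>
    also have "\<dots> \<le> (\<Sum>a<M. card (G a) + 2 * (2 * n * n))"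
      unfolding G_def by (intro sum_mono card_middle_elements fin\<Gamma>)
    also have "\<dots> = (\<Sum>a<M. card (G a)) + 4 * n ^ 2 * M"
      by (simp add: sum.distrib power2_eq_square)
    finally have "4 * n ^ 2 * card {M..<2 * M} \<le> (\<Sum>a<M. card (G a))" using cardH by simp
    moreover have "{M..<2 * M} \<noteq> {}" using n M by simp
    moreover have "G a \<subseteq> {M..<2 * M}" for a using \<Gamma>_sub G_def by blast
    ultimately obtain c where c: "4 * n ^ 2 \<le> card {a\<in>{..<M}. c \<in> G a}"
      using popular_element[of "{..<M}" "{M..<2 * M}" G "4 * n ^ 2"] by blast
    define S where "S = {a\<in>{..<M}. c \<in> G a}"
    have "2 * n \<le> 4 * n ^ 2" using n by (simp add: power2_eq_square)
    then have S: "finite S" "2 * n \<le> card S" using c by (auto simp: S_def)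
    show ?thesis
    proof (cases "\<exists>a\<in>S. \<exists>a'\<in>S. a < a' \<and> K a a'")
      case False
      then have "\<exists>u v. index_ladder (\<lambda>i j. K i j = False) S n u v"
        using S by (intro index_ladder_of_clique) auto
      then obtain u v where "index_ladder (\<lambda>i j. K i j = False) S n u v" by blast
      then have "index_ladder (\<lambda>i j. K i j = False) {..<2 * M} n u v"
        by (rule index_ladder_mono) (auto simp: S_def)
      then show ?thesis by blast
    next
      case True
      then obtain a a' where a: "a \<in> S" "a' \<in> S" "a < a'" "K a a'" by blast
      define X where "X = {x\<in>\<Gamma> a. c < x}"
      define Y where "Y = {x\<in>\<Gamma> a'. x \<le> c}"
      \<comment> \<open>If \<open>K y x\<close> held, rung \<open>(a', y)\<close> would extend rung
        \<open>(a, x)\<close>, since \<open>a < a'\<close>, \<open>y < x\<close> and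
        \<open>K a a'\<close>. Hence the bipartite pattern has the complementary colour.\<close>
      have "y < x \<and> \<not> K y x" if "y \<in> Y" "x \<in> X" for x y
        using that a indep[of "(a, x)" "(a', y)"] by (auto simp: X_def Y_def \<Gamma>_def r_def)
      moreover have "2 * n * n \<le> card Y" "2 * n * n \<le> card X"
        using a by (auto simp: S_def G_def X_def Y_def)
      moreover have "finite X" "finite Y" using fin\<Gamma> by (auto simp: X_def Y_def)
      ultimately obtain col u v where "index_ladder (\<lambda>i j. (\<not> K i j) = col) (Y \<union> X) n u v"
        using index_ladder_of_blown_up_edge[of Y X n "\<lambda>i j. \<not> K i j"] by blast
      moreover have "Y \<union> X \<subseteq> {..<2 * M}" using \<Gamma>_sub by (fastforce simp: X_def Y_def)
      ultimately have "index_ladder (\<lambda>i j. (\<not> K i j) = col) {..<2 * M} n u v" by (rule index_ladder_mono)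
      moreover have "(\<lambda>i j. (\<not> K i j) = col) = (\<lambda>i j. K i j = (\<not> col))" by auto
      ultimately show ?thesis by metis
    qed
  qed
qed

text \<open>One of the two colours has at least half of the pairs between the halves; if it is the
  complement of \<open>K\<close>, the colours are swapped and swapped back.\<close>

lemma index_ladder_exists:
  fixes K :: "nat \<Rightarrow> nat \<Rightarrow> bool"
  assumes n: "n \<ge> 1"
  shows "\<exists>col u v. index_ladder (\<lambda>i j. K i j = col) {..<32 * n ^ 3} n u v"
proof -
  define M where "M = 16 * n ^ 3"
  define E where "E = (\<lambda>Q. {(a, b). a < M \<and> M \<le> b \<and> b < 2 * M \<and> Q a b})"
  have 2: "32 * n ^ 3 = 2 * M" by (simp add: M_def)
  have "M * M = card ({..<M} \<times> {M..<2 * M})" by simp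
  also have "{..<M} \<times> {M..<2 * M} = E K \<union> E (\<lambda>a b. \<not> K a b)" by (auto simp: E_def)
  also have "card \<dots> \<le> card (E K) + card (E (\<lambda>a b. \<not> K a b))" by (rule card_Un_le)
  finally have "M * M \<le> card (E K) + card (E (\<lambda>a b. \<not> K a b))" .
  then consider "M * M \<le> 2 * card (E K)" | "M * M \<le> 2 * card (E (\<lambda>a b. \<not> K a b))" by linarith
  then show ?thesis
  proof cases
    case 1
    then show ?thesis unfolding 2 E_def by (rule index_ladder_of_dense[OF n M_def])
  next
    case 2
    then obtain col u v where "index_ladder (\<lambda>i j. (\<not> K i j) = col) {..<2 * M} n u v"
      using index_ladder_of_dense[OF n M_def, of "\<lambda>i j. \<not> K i j"] unfolding E_def by blast
    moreover have "(\<lambda>i j. (\<not> K i j) = col) = (\<lambda>i j. K i j = (\<not> col))" by auto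
    ultimately show ?thesis unfolding \<open>32 * n ^ 3 = 2 * M\<close> by metis
  qed
qed

section \<open>Cyclic order of points in convex position\<close>

text \<open>Twice the signed area of the triangle, positive for a counterclockwise turn.\<close>

definition orient :: "point \<Rightarrow> point \<Rightarrow> point \<Rightarrow> real" where
  "orient a b c = (fst b - fst a) * (snd c - snd a) - (snd b - snd a) * (fst c - fst a)"

text \<open>The barycentric coordinates of \<open>b\<close> are ratios of signed areas to that of
  the whole triangle; the sign hypotheses make them nonnegative.\<close>

lemma in_triangle_hull:
  assumes "orient o' a b \<ge> 0" "orient o' b c \<ge> 0" "orient a b c \<le> 0" "orient o' a c > 0"
  shows "b \<in> convex hull {o', a, c}"
proof -
  define T where "T = orient o' a c"
  have T: "T = - orient a b c + orient o' b c + orient o' a b"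
    by (simp add: T_def orient_def algebra_simps)
  have "T > 0" using assms T_def by simp
  have "T *\<^sub>R b = (- orient a b c) *\<^sub>R o' + orient o' b c *\<^sub>R a + orient o' a b *\<^sub>R c"
    by (rule prod_eqI) (simp_all add: T_def orient_def algebra_simps)
  then have "b = inverse T *\<^sub>R ((- orient a b c) *\<^sub>R o' + orient o' b c *\<^sub>R a + orient o' a b *\<^sub>R c)"
    using \<open>T > 0\<close> by (metis scaleR_scaleR left_inverse scaleR_one order_less_irrefl)
  then have "b = (- orient a b c / T) *\<^sub>R o' + (orient o' b c / T) *\<^sub>R a + (orient o' a b / T) *\<^sub>R c"
    by (simp add: scaleR_right_diff_distrib scaleR_add_right divide_inverse mult.commute)
  moreover have "- orient a b c / T + orient o' b c / T + orient o' a b / T = 1"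
    using \<open>T > 0\<close> T by (simp add: field_simps)
  moreover have "- orient a b c / T \<ge> 0" "orient o' b c / T \<ge> 0" "orient o' a b / T \<ge> 0"
    using assms \<open>T > 0\<close> by (auto intro!: divide_nonneg_pos simp: divide_nonpos_pos)
  ultimately show ?thesis unfolding convex_hull_3 by blast
qed

lemma convex_pos_notin_hull:
  assumes "convex_pos P" "b \<in> P" "S \<subseteq> P" "b \<notin> S"
  shows "b \<notin> convex hull S"
  using assms hull_mono[of S "P - {b}" convex] unfolding convex_pos_def by blast

text \<open>A line separates \<open>z\<close> from the other points, so these lie in an open
  half-plane seen from \<open>z\<close> and the slope relative to the normal \<open>w\<close> sorts
  them by angle. Equal slopes would put one point on the segment from \<open>z\<close> to another,
  against convex position.\<close>

lemma convex_pos_radial_key: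
  assumes P: "convex_pos P" and z: "z \<in> P"
  obtains s :: "point \<Rightarrow> real" where "inj_on s (P - {z})"
    and "\<And>q r. q \<in> P - {z} \<Longrightarrow> r \<in> P - {z} \<Longrightarrow> s q < s r \<Longrightarrow> orient z q r > 0"
proof -
  have "finite P" and zh: "z \<notin> convex hull (P - {z})" using P z by (auto simp: convex_pos_def)
  then have "closed (convex hull (P - {z}))"
    by (simp add: compact_convex_hull compact_imp_closed finite_imp_compact)
  then obtain w b where w: "inner w z < b" "\<And>x. x \<in> convex hull (P - {z}) \<Longrightarrow> inner w x > b"
    using separating_hyperplane_closed_point[OF _ _ zh] by (metis convex_convex_hull)
  \<comment> \<open>Up to the factor \<open>norm w\<close>, \<open>d\<close> and \<open>e\<close>
    are the coordinates of \<open>q - z\<close> along \<open>w\<close> and along \<open>w\<close>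
    turned counterclockwise by a right angle. The key is \<open>e q / d q\<close>.\<close>
  define d where "d q = inner w (q - z)" for q
  define e where "e q = fst w * (snd q - snd z) - snd w * (fst q - fst z)" for q
  have d_pos: "d q > 0" if "q \<in> P - {z}" for q
    using w(1) w(2)[OF hull_inc[OF that]] by (simp add: d_def inner_diff_right)
  have de: "d q * e r - e q * d r = (fst w ^ 2 + snd w ^ 2) * orient z q r" for q r
    by (simp add: d_def e_def orient_def inner_prod_def algebra_simps power2_eq_square)
  have w_pos: "fst w ^ 2 + snd w ^ 2 > 0" if "q \<in> P - {z}" for q
  proof -
    have "w \<noteq> 0" using d_pos[OF that] by (auto simp: d_def)
    then show ?thesis by (auto simp: prod_eq_iff sum_power2_gt_zero_iff)
  qed
  have ray: "q \<in> convex hull {z, r}"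
    if qr: "q \<in> P - {z}" "r \<in> P - {z}" "e q / d q = e r / d r" "d q \<le> d r" for q r
  proof -
    define t where "t = d q / d r"
    have t: "0 \<le> t" "t \<le> 1" using d_pos qr by (auto simp: t_def less_imp_le)
    have eqs: "d q = t * d r" "e q = t * e r"
      using d_pos[of q] d_pos[of r] qr by (auto simp: t_def field_simps)
    let ?W = "fst w ^ 2 + snd w ^ 2"
    have "?W * (fst q - fst z) = fst w * d q - snd w * e q" for q
      by (simp add: d_def e_def inner_prod_def algebra_simps power2_eq_square)
    then have "?W * (fst q - fst z) = ?W * (t * (fst r - fst z))"
      using eqs by (metis (no_types, lifting) mult.left_commute right_diff_distrib)
    moreover have "?W * (snd q - snd z) = snd w * d q + fst w * e q" for q
      by (simp add: d_def e_def inner_prod_def algebra_simps power2_eq_square)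
    then have "?W * (snd q - snd z) = ?W * (t * (snd r - snd z))"
      using eqs by (metis (no_types, lifting) mult.left_commute distrib_left)
    ultimately have "fst q - fst z = t * (fst r - fst z)" "snd q - snd z = t * (snd r - snd z)"
      using w_pos[OF qr(1)] by auto
    then have "q = (1 - t) *\<^sub>R z + t *\<^sub>R r" by (auto simp: prod_eq_iff algebra_simps)
    then show ?thesis using t by (auto simp: segment_convex_hull[symmetric] in_segment)
  qed
  show thesis
  proof (rule that[of "\<lambda>q. e q / d q"])
    show "inj_on (\<lambda>q. e q / d q) (P - {z})"
    proof (rule inj_onI, rule ccontr)
      fix q r assume qr: "q \<in> P - {z}" "r \<in> P - {z}" "e q / d q = e r / d r" "q \<noteq> r"
      then have "q \<in> convex hull {z, r} \<or> r \<in> convex hull {z, q}"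
        using ray[of q r] ray[of r q] by (metis linear)
      then show False
        using qr z convex_pos_notin_hull[OF P, of q "{z, r}"] convex_pos_notin_hull[OF P, of r "{z, q}"] by auto
    qed
  next
    fix q r assume qr: "q \<in> P - {z}" "r \<in> P - {z}" "e q / d q < e r / d r"
    then have "d q * e r - e q * d r > 0"
      using d_pos[of q] d_pos[of r] by (simp add: field_simps)
    then show "orient z q r > 0"
      unfolding de using w_pos[OF qr(1)] by (simp add: zero_less_mult_iff)
  qed
qed

text \<open>Take any point as \<open>p 0\<close> and sort the rest by angle around it; triples
  containing \<open>p 0\<close> are then positive. A non-positive triple \<open>i < j < k\<close>
  with \<open>0 < i\<close> would put \<open>p j\<close> into the triangle of \<open>p 0\<close>,
  \<open>p i\<close>, \<open>p k\<close>.\<close>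

lemma convex_pos_cyclic_order:
  assumes P: "convex_pos P"
  obtains p where "bij_betw p {..<card P} P"
    and "\<And>i j k. i < j \<Longrightarrow> j < k \<Longrightarrow> k < card P \<Longrightarrow> orient (p i) (p j) (p k) > 0"
proof (cases "P = {}")
  case True
  then show thesis using that by (auto simp: bij_betw_def)
next
  case False
  then obtain z where z: "z \<in> P" by blast
  have fin: "finite P" using P by (simp add: convex_pos_def)
  obtain s :: "point \<Rightarrow> real" where inj: "inj_on s (P - {z})"
    and s: "\<And>q r. q \<in> P - {z} \<Longrightarrow> r \<in> P - {z} \<Longrightarrow> s q < s r \<Longrightarrow> orient z q r > 0"
    using convex_pos_radial_key[OF P z] by blast
  define l where "l = sorted_list_of_set (s ` (P - {z}))"
  have len: "Suc (length l) = card P"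
    using fin z inj by (simp add: l_def card_image card_Suc_Diff1 del: card_Diff_insert card_Diff_singleton)
  have l: "set l = s ` (P - {z})" "sorted_wrt (<) l" "distinct l" using fin by (auto simp: l_def)
  define g where "g = the_inv_into (P - {z}) s"
  define p where "p i = (case i of 0 \<Rightarrow> z | Suc j \<Rightarrow> g (l ! j))" for i
  have g_bij: "bij_betw g (set l) (P - {z})"
    using inj by (simp add: g_def l bij_betw_the_inv_into bij_betw_imageI)
  have nth_bij: "bij_betw ((!) l) {..<length l} (set l)"
    using l(3) by (intro bij_betw_nth) auto
  have tail: "bij_betw (\<lambda>j. g (l ! j)) {..<length l} (P - {z})"
    using bij_betw_trans[OF nth_bij g_bij] by (simp add: comp_def)
  have "bij_betw p (Suc ` {..<length l}) (P - {z})"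
    using tail by (simp add: p_def bij_betw_def inj_on_def image_image)
  then have "bij_betw p (Suc ` {..<length l} \<union> {0}) ((P - {z}) \<union> {p 0})"
    by (subst notIn_Un_bij_betw3[symmetric]) (auto simp: p_def)
  moreover have "Suc ` {..<length l} \<union> {0} = {..<card P}" using len
    by (auto simp: image_iff less_Suc_eq_0_disj simp flip: len)
  moreover have "(P - {z}) \<union> {p 0} = P" using z by (auto simp: p_def)
  ultimately have bij: "bij_betw p {..<card P} P" by simp
  have mem: "p (Suc i) \<in> P - {z}" if "Suc i < card P" for i
    using tail that len by (auto simp: p_def bij_betw_def)
  have sp: "s (p (Suc i)) = l ! i" if "Suc i < card P" for i
  proof -
    have "l ! i \<in> s ` (P - {z})" using that len l(1) nth_mem[of i l] by simp
    then show ?thesis using inj by (simp add: p_def g_def f_the_inv_into_f)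
  qed
  have fan: "orient (p 0) (p i) (p j) > 0" if ij: "0 < i" "i < j" "j < card P" for i j
  proof -
    obtain i' j' where Suc: "i = Suc i'" "j = Suc j'" using ij by (metis gr0_conv_Suc less_trans)
    have "l ! i' < l ! j'" using ij Suc len l(2) by (auto intro: sorted_wrt_nth_less)
    then have "s (p i) < s (p j)" using Suc ij sp by simp
    then show ?thesis using s mem Suc ij by (simp add: p_def)
  qed
  have "orient (p i) (p j) (p k) > 0" if ijk: "i < j" "j < k" "k < card P" for i j k
  proof (cases "i = 0")
    case True
    then show ?thesis using fan ijk by simp
  next
    case False
    show ?thesis
    proof (rule ccontr)
      assume "\<not> ?thesis"
      then have "p j \<in> convex hull {p 0, p i, p k}"
        using ijk False fan[of i j] fan[of j k] fan[of i k] by (intro in_triangle_hull) auto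
      moreover have "p j \<notin> {p 0, p i, p k}"
        using bij_betw_imp_inj_on[OF bij] ijk False by (auto simp: inj_on_eq_iff)
      moreover have "p m \<in> P" if "m \<le> k" for m
        using bij_betwE[OF bij] that ijk by auto
      ultimately show False
        using convex_pos_notin_hull[OF P, of "p j" "{p 0, p i, p k}"] ijk by auto
    qed
  qed
  then show thesis using that bij by blast
qed

section \<open>From index intervals to non-crossing segments\<close>

text \<open>The affine function \<open>g\<close> vanishes on the line through \<open>p i\<close> and
  \<open>p j\<close>, is negative at indices strictly between \<open>i\<close> and \<open>j\<close>
  and positive at those outside. By \<open>side\<close>, both ends of the other segment lie in one
  closed half-plane, so it can meet the line only at an end where \<open>g\<close> vanishes.\<close>

lemma noncrossing_segments:
  fixes p :: "nat \<Rightarrow> point"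
  assumes orient: "\<And>i j k. i < j \<Longrightarrow> j < k \<Longrightarrow> k < N \<Longrightarrow> orient (p i) (p j) (p k) > 0"
    and ij: "i < j" "j < N" and kl: "k < l" "l < N"
    and neq: "(i, j) \<noteq> (k, l)"
    and side: "{k, l} \<subseteq> {i..j} \<or> {k, l} \<inter> {i<..<j} = {}"
  shows "closed_segment (p i) (p j) \<inter> closed_segment (p k) (p l) \<subseteq> {p i, p j} \<inter> {p k, p l}"
proof
  define g where "g = orient (p i) (p j)"
  have g0: "g (p i) = 0" "g (p j) = 0" by (simp_all add: g_def orient_def)
  have out: "g (p m) > 0" if "m < i \<or> j < m" "m < N" for m
    using orient[of m i j] orient[of i j m] that ij by (auto simp: g_def orient_def algebra_simps)
  have ins: "g (p m) < 0" if "i < m" "m < j" for m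
    using orient[of i m j] that ij by (auto simp: g_def orient_def algebra_simps)
  have aff: "g ((1 - t) *\<^sub>R a + t *\<^sub>R b) = (1 - t) * g a + t * g b" for a b t
    by (simp add: g_def orient_def algebra_simps)
  have zero: "m = i \<or> m = j" if "g (p m) = 0" "m < N" for m
    using out[of m] ins[of m] that by (cases m i rule: linorder_cases; cases m j rule: linorder_cases) auto
  have sgn: "(g (p k) \<le> 0 \<and> g (p l) \<le> 0) \<or> (g (p k) \<ge> 0 \<and> g (p l) \<ge> 0)"
    using side
  proof
    assume "{k, l} \<subseteq> {i..j}"
    then have "g (p m) \<le> 0" if "m \<in> {k, l}" for m
      using that g0 ins[of m] by (cases "m = i \<or> m = j") force+
    then show ?thesis by simp
  next
    assume "{k, l} \<inter> {i<..<j} = {}"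
    then have "g (p m) \<ge> 0" if "m \<in> {k, l}" for m
      using that g0 out[of m] kl by (cases "m = i \<or> m = j") force+
    then show ?thesis by simp
  qed
  fix x assume x: "x \<in> closed_segment (p i) (p j) \<inter> closed_segment (p k) (p l)"
  then obtain t where "x = (1 - t) *\<^sub>R p i + t *\<^sub>R p j" by (auto simp: in_segment)
  then have gx: "g x = 0" using g0 aff by simp
  obtain t where t: "0 \<le> t" "t \<le> 1" "x = (1 - t) *\<^sub>R p k + t *\<^sub>R p l" using x by (auto simp: in_segment)
  have sum0: "(1 - t) * g (p k) + t * g (p l) = 0" using gx aff t by simp
  have prods: "(1 - t) * g (p k) = 0" "t * g (p l) = 0"
  proof -
    have "((1 - t) * g (p k) \<le> 0 \<and> t * g (p l) \<le> 0) \<or> ((1 - t) * g (p k) \<ge> 0 \<and> t * g (p l) \<ge> 0)"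
      using sgn t by (auto simp: mult_nonneg_nonpos)
    then show "(1 - t) * g (p k) = 0" "t * g (p l) = 0" using sum0 by linarith+
  qed
  \<comment> \<open>Two zeros would force \<open>{k, l} = {i, j}\<close>, and both pairs are
    increasing.\<close>
  have "\<not> (g (p k) = 0 \<and> g (p l) = 0)"
    using zero[of k] zero[of l] kl neq ij by auto
  then consider "g (p k) = 0" "t = 0" | "g (p l) = 0" "t = 1" using prods by auto
  then show "x \<in> {p i, p j} \<inter> {p k, p l}"
    using t zero[of k] zero[of l] kl by cases auto
qed

lemma index_ladder_order:
  assumes "index_ladder K S n u v"
  shows index_ladder_u_less: "1 \<le> i \<Longrightarrow> i < j \<Longrightarrow> j \<le> n \<Longrightarrow> u i < u j"
    and index_ladder_v_less: "1 \<le> i \<Longrightarrow> i < j \<Longrightarrow> j \<le> n \<Longrightarrow> v j < v i"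
    and index_ladder_u_less_v: "1 \<le> i \<Longrightarrow> i \<le> n \<Longrightarrow> 1 \<le> j \<Longrightarrow> j \<le> n \<Longrightarrow> u i < v j"
proof -
  have steps: "u i < u (Suc i)" "v (Suc i) < v i" if "1 \<le> i" "i < n" for i
    using assms that by (auto simp: index_ladder_def)
  have *: "u i < u (i + Suc d) \<and> v (i + Suc d) < v i" if "1 \<le> i" "i + Suc d \<le> n" for i d
    using that
  proof (induction d)
    case (Suc d)
    then show ?case using steps[of "i + Suc d"] by fastforce
  qed (use steps in auto)
  show u: "u i < u j" if "1 \<le> i" "i < j" "j \<le> n" for i j
    using that *[of i "j - Suc i"] by simp
  show v: "v j < v i" if "1 \<le> i" "i < j" "j \<le> n" for i j
    using that *[of i "j - Suc i"] by simp
  show "u i < v j" if ij: "1 \<le> i" "i \<le> n" "1 \<le> j" "j \<le> n" for i j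
  proof -
    have rung: "u i < v i" using assms ij by (auto simp: index_ladder_def)
    have "u j < v j" using assms ij by (auto simp: index_ladder_def)
    \<comment> \<open>For different indices, pass through the rung with the larger index.\<close>
    with rung show ?thesis using u[of i j] v[of j i] ij by (cases i j rule: linorder_cases) auto
  qed
qed

text \<open>Every edge is listed with its smaller index first, the form
  \<open>noncrossing_segments\<close> expects; hence the reversed pairs on the \<open>v\<close>
  side.\<close>

definition ladder_intervals :: "nat \<Rightarrow> (nat \<Rightarrow> nat) \<Rightarrow> (nat \<Rightarrow> nat) \<Rightarrow> (nat \<times> nat) set" where
  "ladder_intervals n u v =
     {(u i, u (Suc i)) | i. i \<in> {1..<n}} \<union> {(v (Suc i), v i) | i. i \<in> {1..<n}} \<union> {(u i, v i) | i. i \<in> {1..n}}"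

text \<open>Side edges join neighbours in the order
  \<open>u 1 < \<dots> < u n < v n < \<dots> < v 1\<close>, so no ladder vertex lies strictly inside
  them. Rungs are nested, and no side edge straddles an end of a rung.\<close>

lemma ladder_intervals_nested_or_apart:
  assumes L: "index_ladder K S n u v"
    and "(a, b) \<in> ladder_intervals n u v" "(k, l) \<in> ladder_intervals n u v"
  shows "{k, l} \<subseteq> {a..b} \<or> {k, l} \<inter> {a<..<b} = {}"
proof -
  note less = index_ladder_order[OF L]
  have u: "u i \<le> u j \<longleftrightarrow> i \<le> j" if "i \<in> {1..n}" "j \<in> {1..n}" for i j
    using that less(1)[of i j] less(1)[of j i] by (cases i j rule: linorder_cases) auto
  have v: "v i \<le> v j \<longleftrightarrow> j \<le> i" if "i \<in> {1..n}" "j \<in> {1..n}" for i j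
    using that less(2)[of i j] less(2)[of j i] by (cases i j rule: linorder_cases) auto
  have uv: "u i \<le> v j \<and> \<not> v j \<le> u i" if "i \<in> {1..n}" "j \<in> {1..n}" for i j
    using that less(3)[of i j] by auto
  show ?thesis
    using assms(2,3) unfolding ladder_intervals_def
    by (auto simp: u v uv simp flip: not_le)
qed

theorem theoremt:
  fixes n :: nat
  assumes "n \<ge> 1"
  shows "(\<exists>N. rc_holds (ladder_V n) (ladder_E n) N)
         \<and> Rc (ladder_V n) (ladder_E n) \<le> 32 * n ^ 3"
proof -
  have "\<exists>\<phi>. mono_noncrossing_copy (ladder_V n) (ladder_E n) P c \<phi>"
    if P: "convex_pos P" "card P = 32 * n ^ 3" for P :: "point set" and c
  proof -
    obtain p where bij: "bij_betw p {..<32 * n ^ 3} P"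
      and orient: "\<And>i j k. i < j \<Longrightarrow> j < k \<Longrightarrow> k < 32 * n ^ 3 \<Longrightarrow> orient (p i) (p j) (p k) > 0"
      using convex_pos_cyclic_order[OF P(1)] P(2) by metis
    obtain col u v where L: "index_ladder (\<lambda>i j. c {p i, p j} = col) {..<32 * n ^ 3} n u v"
      using index_ladder_exists[OF assms, of "\<lambda>i j. c {p i, p j}"] by blast
    note less = index_ladder_order[OF L]
    \<comment> \<open>\<open>q\<close> places ladder vertices on indices; the embedding is
      \<open>p \<circ> q\<close>.\<close>
    define q where "q = (\<lambda>(b, i). if b then v i else u i)"
    have bounds: "q x < 32 * n ^ 3" if "x \<in> ladder_V n" for x
      using L that by (auto simp: q_def ladder_V_def index_ladder_def)
    have "inj_on q (ladder_V n)"
    proof (rule inj_onI, clarify)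
      fix b i b' j assume "(b, i) \<in> ladder_V n" "(b', j) \<in> ladder_V n" "q (b, i) = q (b', j)"
      then show "b = b' \<and> i = j"
        using less(1)[of i j] less(1)[of j i] less(2)[of i j] less(2)[of j i] less(3)[of i j] less(3)[of j i]
        by (cases b; cases b'; cases i j rule: linorder_cases) (simp_all add: q_def ladder_V_def)
    qed
    then have inj: "inj_on (p \<circ> q) (ladder_V n)"
      using bij bounds by (intro comp_inj_on) (auto simp: bij_betw_def inj_on_def)
    have img: "(p \<circ> q) ` ladder_V n \<subseteq> P"
      using bij_betwE[OF bij] bounds by auto
    have interval: "\<exists>i j. (i, j) \<in> ladder_intervals n u v \<and> i < j \<and> j < 32 * n ^ 3 \<and> c {p i, p j} = col
        \<and> {p (q x), p (q y)} = {p i, p j} \<and> closed_segment (p (q x)) (p (q y)) = closed_segment (p i) (p j)"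
      if "(x, y) \<in> ladder_E n" for x y
    proof -
      from that consider i where "1 \<le> i" "i < n" "x = (False, i)" "y = (False, Suc i)"
        | i where "1 \<le> i" "i < n" "x = (True, i)" "y = (True, Suc i)"
        | i where "1 \<le> i" "i \<le> n" "x = (False, i)" "y = (True, i)"
        unfolding ladder_E_def by auto
      then show ?thesis
      proof cases
        case (1 i)
        then show ?thesis using L
          by (intro exI[of _ "u i"] exI[of _ "u (Suc i)"])
             (auto simp: q_def ladder_intervals_def index_ladder_def)
      next
        case (2 i)
        then show ?thesis using L
          by (intro exI[of _ "v (Suc i)"] exI[of _ "v i"])
             (auto simp: q_def ladder_intervals_def index_ladder_def closed_segment_commute)
      next
        case (3 i)
        then show ?thesis using L
          by (intro exI[of _ "u i"] exI[of _ "v i"])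
             (auto simp: q_def ladder_intervals_def index_ladder_def)
      qed
    qed
    have cross: "closed_segment (p (q x)) (p (q y)) \<inter> closed_segment (p (q x')) (p (q y'))
          \<subseteq> {p (q x), p (q y)} \<inter> {p (q x'), p (q y')}
        \<or> {p (q x), p (q y)} = {p (q x'), p (q y')}"
      if edges: "(x, y) \<in> ladder_E n" "(x', y') \<in> ladder_E n" for x y x' y'
    proof -
      obtain i j where ij: "(i, j) \<in> ladder_intervals n u v" "i < j" "j < 32 * n ^ 3"
        "{p (q x), p (q y)} = {p i, p j}" "closed_segment (p (q x)) (p (q y)) = closed_segment (p i) (p j)"
        using interval[OF edges(1)] by metis
      obtain k l where kl: "(k, l) \<in> ladder_intervals n u v" "k < l" "l < 32 * n ^ 3"
        "{p (q x'), p (q y')} = {p k, p l}" "closed_segment (p (q x')) (p (q y')) = closed_segment (p k) (p l)"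
        using interval[OF edges(2)] by metis
      show ?thesis
      \<comment> \<open>Equal intervals mean the same edge, which the second disjunct of the
        definition permits.\<close>
      proof (cases "(i, j) = (k, l)")
        case True
        then show ?thesis using ij kl by simp
      next
        case False
        have "closed_segment (p i) (p j) \<inter> closed_segment (p k) (p l) \<subseteq> {p i, p j} \<inter> {p k, p l}"
          using orient ij(2,3) kl(2,3) False ladder_intervals_nested_or_apart[OF L ij(1) kl(1)]
          by (rule noncrossing_segments)
        then show ?thesis unfolding ij(4,5) kl(4,5) by blast
      qed
    qed
    have "mono_noncrossing_copy (ladder_V n) (ladder_E n) P c (p \<circ> q)"
      unfolding mono_noncrossing_copy_def
    proof (intro conjI inj img exI[of _ col])
      show "\<forall>(x, y)\<in>ladder_E n. c {(p \<circ> q) x, (p \<circ> q) y} = col"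
        using interval by fastforce
    next
      show "\<forall>(x, y)\<in>ladder_E n. \<forall>(x', y')\<in>ladder_E n.
          closed_segment ((p \<circ> q) x) ((p \<circ> q) y) \<inter> closed_segment ((p \<circ> q) x') ((p \<circ> q) y')
            \<subseteq> {(p \<circ> q) x, (p \<circ> q) y} \<inter> {(p \<circ> q) x', (p \<circ> q) y'}
          \<or> {(p \<circ> q) x, (p \<circ> q) y} = {(p \<circ> q) x', (p \<circ> q) y'}"
        unfolding comp_def by (rule ballI, rule case_prodI2, rule ballI, rule case_prodI2, rule cross) simp_all
    qed
    then show ?thesis by blast
  qed
  then have "rc_holds (ladder_V n) (ladder_E n) (32 * n ^ 3)"
    unfolding rc_holds_def by blast
  then show ?thesis
    unfolding Rc_def by (auto intro: Least_le)
qed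

end
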